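(* Let $k \ge 2$ be an integer and $n \ge k+1$. If $\mathcal{F} \subseteq 2^{[n]}$ contains neither $Y_k$ nor $Y'_k$ as an induced subposet and $\varnothing \notin \mathcal{F}$, $[n] \notin \mathcal{F}$, then $$\sum_{F\in \mathcal{F}} \binom{n}{|F|}^{-1} \le k.$$ In particular, $|\mathcal{F}|\le \Sigma(n,k)$.
   Context: $[n]=\{1,\dots,n\}$ and $2^{[n]}$ is ordered by inclusion. For an integer $k\ge 2$, the poset $Y_k$ consists of $k+2$ distinct elements $x_1,\dots,x_k,y_1,y_2$ with $x_1 < x_2 < \dots < x_k$ and $x_k < y_1$, $x_k < y_2$ (and the relations implied by transitivity; $y_1,y_2$ incomparable). $Y'_k$ is the dual (reversed) poset of $Y_k$. A poset $P$ is contained in a family $\mathcal{F}$ as an induced subposet if there is an injection $\alpha: P \to \mathcal{F}$ with $x_1 <_P x_2 \iff \alpha(x_1) \subsetneq \alpha(x_2)$ for all $x_1,x_2 \in P$. $\Sigma(n,k)$ denotes the sum of the $k$ largest binomial coefficients $\binom{n}{i}$, $0\le i\le n$. *)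

theory Defs
  imports Complex_Main
begin

text \<open>A finite poset is given by its carrier \<open>P\<close> and its strict order \<open>lt\<close>, of which only the
  restriction to \<open>P\<close> matters.\<close>

definition contains_induced ::
    "'p set \<Rightarrow> ('p \<Rightarrow> 'p \<Rightarrow> bool) \<Rightarrow> 'a set set \<Rightarrow> bool" where
  "contains_induced P lt \<F> \<longleftrightarrow>
     (\<exists>\<alpha>. inj_on \<alpha> P \<and> \<alpha> ` P \<subseteq> \<F> \<and> (\<forall>p\<in>P. \<forall>q\<in>P. lt p q \<longleftrightarrow> \<alpha> p \<subset> \<alpha> q))"

datatype Y_elem = X nat | Y nat

definition Y_carrier :: "nat \<Rightarrow> Y_elem set" where
  "Y_carrier k = X ` {1..k} \<union> Y ` {1, 2}"

fun Y_less :: "Y_elem \<Rightarrow> Y_elem \<Rightarrow> bool" where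
  "Y_less (X i) (X j) \<longleftrightarrow> i < j"
| "Y_less (X i) (Y j) \<longleftrightarrow> True"
| "Y_less (Y i) q \<longleftrightarrow> False"

definition contains_Y :: "nat \<Rightarrow> 'a set set \<Rightarrow> bool" where
  "contains_Y k \<F> \<longleftrightarrow> contains_induced (Y_carrier k) Y_less \<F>"

definition contains_Y_dual :: "nat \<Rightarrow> 'a set set \<Rightarrow> bool" where
  "contains_Y_dual k \<F> \<longleftrightarrow> contains_induced (Y_carrier k) (\<lambda>p q. Y_less q p) \<F>"

text \<open>The \<open>k\<close> largest binomial coefficients are counted with multiplicity, one for each index
  \<open>0 \<le> i \<le> n\<close>.\<close>

definition largest_binomials_sum :: "nat \<Rightarrow> nat \<Rightarrow> nat" where
  "largest_binomials_sum n k = sum_list (take k (rev (sort (map (\<lambda>i. n choose i) [0..<Suc n]))))"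

end

theory Submission
  imports Defs "HOL-Combinatorics.Multiset_Permutations" "HOL-Library.Infinite_Set"
begin

text \<open>Double count full chains of the Boolean lattice by the number of family members they meet. A
  chain meeting \<open>m > k\<close> members \<open>F\<^sub>1 \<subset> \<dots> \<subset> F\<^sub>m\<close> has \<open>m - k\<close> windows of \<open>k - 1\<close> consecutive members
  \<open>P \<subset> \<dots> \<subset> Q\<close> with further members both below and above. Complement the chain inside
  \<open>[{}, P]\<close> and inside \<open>[Q, V]\<close>, keeping the part between. A nonempty complemented set below \<open>P\<close>
  is incomparable to every member the old chain meets there, whereas by freeness any two members
  below \<open>P\<close> are comparable; dually above \<open>Q\<close>. So the new full chain meets exactly the window.
  Since \<open>P\<close> and \<open>Q\<close> are then the extreme members met, this is an injection from windows to full
  chains with exactly \<open>k - 1\<close> members; hence the surplus over \<open>k\<close> never exceeds the deficit.\<close>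

section \<open>Extending chains to induced copies of \<open>Y\<^sub>k\<close>\<close>

lemma finite_chain_enumeration:
  fixes C :: "'a::order set"
  assumes "finite C" and chain: "Complete_Partial_Order.chain (\<le>) C"
  obtains g where "bij_betw g {1..card C} C"
    and "\<And>i j. \<lbrakk>i \<in> {1..card C}; j \<in> {1..card C}\<rbrakk> \<Longrightarrow> g i < g j \<longleftrightarrow> i < j"
proof -
  define rank where "rank x = card {y \<in> C. y \<le> x}" for x
  have rank_less: "rank x < rank y" if "y \<in> C" "x < y" for x y
  proof -
    have "y \<in> {z \<in> C. z \<le> y} - {z \<in> C. z \<le> x}" "{z \<in> C. z \<le> x} \<subseteq> {z \<in> C. z \<le> y}"
      using that by auto
    then show ?thesis
      unfolding rank_def using \<open>finite C\<close> by (intro psubset_card_mono) auto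
  qed
  have rank_less_iff: "rank x < rank y \<longleftrightarrow> x < y" if "x \<in> C" "y \<in> C" for x y
    using that rank_less[of y x] rank_less[of x y] chainD[OF chain that]
    by (cases "x = y") (auto simp: order_less_le)
  have "inj_on rank C"
    by (intro inj_onI) (metis chainD[OF chain] order_less_irrefl order_le_less rank_less_iff)
  moreover have "rank ` C = {1..card C}"
  proof (rule card_subset_eq)
    show "rank ` C \<subseteq> {1..card C}"
      using \<open>finite C\<close> by (auto simp: rank_def Suc_le_eq card_gt_0_iff intro!: card_mono)
    show "card (rank ` C) = card {1..card C}"
      using \<open>inj_on rank C\<close> by (simp add: card_image)
  qed simp
  ultimately have rank: "bij_betw rank C {1..card C}"
    by (simp add: bij_betw_def)
  define g where "g = inv_into C rank"
  have g: "bij_betw g {1..card C} C"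
    unfolding g_def by (rule bij_betw_inv_into[OF rank])
  moreover have "g i < g j \<longleftrightarrow> i < j" if "i \<in> {1..card C}" "j \<in> {1..card C}" for i j
  proof -
    have "g i \<in> C" "g j \<in> C" "rank (g i) = i" "rank (g j) = j"
      using that g rank by (auto simp: g_def bij_betw_inv_into_right dest: bij_betwE)
    then show ?thesis
      using rank_less_iff[of "g i" "g j"] by simp
  qed
  ultimately show ?thesis by (rule that)
qed

lemma contains_YI:
  assumes "finite C" "Complete_Partial_Order.chain (\<subseteq>) C" "card C = k"
    and "C \<subseteq> \<F>" "A \<in> \<F>" "B \<in> \<F>" and incomparable: "\<not> A \<subseteq> B" "\<not> B \<subseteq> A"
    and below: "\<Union>C \<subseteq> A \<inter> B"
  shows "contains_Y k \<F>"
proof -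
  obtain g where g: "bij_betw g {1..k} C"
    and g_less: "\<And>i j. \<lbrakk>i \<in> {1..k}; j \<in> {1..k}\<rbrakk> \<Longrightarrow> g i \<subset> g j \<longleftrightarrow> i < j"
    using finite_chain_enumeration assms(1-3) by metis
  define \<alpha> where "\<alpha> p = (case p of X i \<Rightarrow> g i | Y j \<Rightarrow> if j = 1 then A else B)" for p
  have g_in: "g i \<in> C" if "i \<in> {1..k}" for i
    using g that by (rule bij_betw_apply)
  have g_below: "g i \<subset> A \<and> g i \<subset> B" if "i \<in> {1..k}" for i
    using g_in[OF that] below incomparable by blast
  have less_iff: "Y_less p q \<longleftrightarrow> \<alpha> p \<subset> \<alpha> q" if "p \<in> Y_carrier k" "q \<in> Y_carrier k" for p q
  proof (cases p; cases q)
    fix i j assume "p = X i" "q = X j"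
    then show ?thesis using that g_less[of i j] by (auto simp: Y_carrier_def \<alpha>_def)
  next
    fix i j assume "p = X i" "q = Y j"
    then show ?thesis using that g_below[of i] by (auto simp: Y_carrier_def \<alpha>_def)
  next
    fix i j assume "p = Y i" "q = X j"
    then show ?thesis using that g_below[of j] by (auto simp: Y_carrier_def \<alpha>_def)
  next
    fix i j assume "p = Y i" "q = Y j"
    then show ?thesis using that incomparable by (auto simp: Y_carrier_def \<alpha>_def)
  qed
  have "inj_on \<alpha> (Y_carrier k)"
  proof (rule inj_onI)
    fix p q assume pq: "p \<in> Y_carrier k" "q \<in> Y_carrier k" "\<alpha> p = \<alpha> q"
    then have "\<not> Y_less p q" "\<not> Y_less q p" using less_iff by auto
    then show "p = q"
      using pq incomparable by (cases p; cases q) (auto simp: Y_carrier_def \<alpha>_def split: if_splits)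
  qed
  moreover have "\<alpha> ` Y_carrier k \<subseteq> \<F>"
    using assms(4-6) g_in by (auto simp: Y_carrier_def \<alpha>_def)
  ultimately show ?thesis
    unfolding contains_Y_def contains_induced_def using less_iff by (intro exI[of _ \<alpha>]) simp
qed

lemma contains_induced_uminusD:
  assumes "contains_induced P lt (uminus ` \<F>)"
  shows "contains_induced P (\<lambda>p q. lt q p) \<F>"
proof -
  obtain \<alpha> where "inj_on \<alpha> P" "\<alpha> ` P \<subseteq> uminus ` \<F>" "\<forall>p\<in>P. \<forall>q\<in>P. lt p q \<longleftrightarrow> \<alpha> p \<subset> \<alpha> q"
    using assms by (auto simp: contains_induced_def)
  then have "inj_on (\<lambda>p. - \<alpha> p) P" "(\<lambda>p. - \<alpha> p) ` P \<subseteq> \<F>"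
    "\<forall>p\<in>P. \<forall>q\<in>P. lt q p \<longleftrightarrow> - \<alpha> p \<subset> - \<alpha> q"
    by (auto simp: inj_on_def)
  then show ?thesis
    unfolding contains_induced_def by blast
qed

lemma contains_Y_dualI:
  assumes "finite C" "Complete_Partial_Order.chain (\<subseteq>) C" "card C = k"
    and "C \<subseteq> \<F>" "A \<in> \<F>" "B \<in> \<F>" "\<not> A \<subseteq> B" "\<not> B \<subseteq> A" "A \<union> B \<subseteq> \<Inter>C"
  shows "contains_Y_dual k \<F>"
proof -
  have "contains_Y k (uminus ` \<F>)"
  proof (rule contains_YI[where C = "uminus ` C" and A = "- A" and B = "- B"])
    show "Complete_Partial_Order.chain (\<subseteq>) (uminus ` C)"
      using assms(2) by (auto simp: chain_def)
    show "card (uminus ` C) = k"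
      using assms(3) by (simp add: card_image inj_on_def)
  qed (use assms in auto)
  then show ?thesis
    unfolding contains_Y_def contains_Y_dual_def by (rule contains_induced_uminusD)
qed

section \<open>Windows of a finite set\<close>

definition windows :: "nat \<Rightarrow> 'a::linorder set \<Rightarrow> ('a \<times> 'a) set" where
  "windows m H = {(a, b). a \<in> H \<and> b \<in> H \<and> a \<le> b \<and> card (H \<inter> {a..b}) = m \<and>
     (\<exists>l\<in>H. l < a) \<and> (\<exists>h\<in>H. b < h)}"

lemma finite_windows [simp]: "finite H \<Longrightarrow> finite (windows m H)"
  by (rule finite_subset[of _ "H \<times> H"]) (auto simp: windows_def)

lemma Int_atLeastAtMost_enumerate:
  fixes H :: "'a::wellorder set"
  assumes "finite H" "j < card H" "i \<le> j"
  shows "H \<inter> {enumerate H i..enumerate H j} = enumerate H ` {i..j}"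
proof -
  have le_iff: "enumerate H p \<le> enumerate H q \<longleftrightarrow> p \<le> q" if "p < card H" "q < card H" for p q
    using that assms(1) by (simp flip: not_less)
  show ?thesis
  proof (intro equalityI subsetI)
    fix x assume x: "x \<in> H \<inter> {enumerate H i..enumerate H j}"
    then obtain p where p: "p < card H" "enumerate H p = x"
      using finite_enumerate_Ex[OF assms(1), of x] by auto
    then have "p \<in> {i..j}"
      using x assms le_iff[of i p] le_iff[of p j] by auto
    then show "x \<in> enumerate H ` {i..j}"
      using p(2) by blast
  next
    fix x assume "x \<in> enumerate H ` {i..j}"
    then obtain p where "i \<le> p" "p \<le> j" "x = enumerate H p" by auto
    then show "x \<in> H \<inter> {enumerate H i..enumerate H j}"
      using assms le_iff[of i p] le_iff[of p j] finite_enumerate_in_set[of H p] by auto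
  qed
qed

lemma card_le_card_windows:
  fixes H :: "'a::wellorder set"
  assumes "finite H" "m > 0"
  shows "card H \<le> Suc m + card (windows m H)"
proof -
  let ?e = "enumerate H"
  have inj: "inj_on ?e {..<card H}"
    using finite_bij_enumerate[OF assms(1)] by (simp add: bij_betw_def)
  have "(?e i, ?e (i + m - 1)) \<in> windows m H" if "i \<in> {1..<card H - m}" for i
  proof -
    have i: "0 < i" "i \<le> i + m - 1" "i + m - 1 < i + m" "i + m < card H"
      using that assms(2) by auto
    then have "inj_on ?e {i..i + m - 1}"
      by (intro inj_on_subset[OF inj]) auto
    moreover have "H \<inter> {?e i..?e (i + m - 1)} = ?e ` {i..i + m - 1}"
      using i assms(1) by (intro Int_atLeastAtMost_enumerate) auto
    ultimately have "card (H \<inter> {?e i..?e (i + m - 1)}) = m"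
      using assms(2) by (simp add: card_image)
    moreover have "?e j \<in> H" if "j < card H" for j
      using assms(1) that by (rule finite_enumerate_in_set)
    moreover have "?e 0 < ?e i" "?e (i + m - 1) < ?e (i + m)" "\<not> ?e (i + m - 1) < ?e i"
      using i assms(1) by (simp_all del: One_nat_def)
    ultimately show ?thesis
      unfolding windows_def using i by auto
  qed
  moreover have "inj_on (\<lambda>i. (?e i, ?e (i + m - 1))) {1..<card H - m}"
    using inj by (auto simp: inj_on_def)
  ultimately have "card {1..<card H - m} \<le> card (windows m H)"
    using assms(1) by (intro card_inj_on_le) auto
  then show ?thesis by simp
qed

section \<open>Reversing both ends of a list\<close>

definition flip_ends :: "nat \<Rightarrow> nat \<Rightarrow> 'a list \<Rightarrow> 'a list" where
  "flip_ends a b xs = rev (take a xs) @ drop a (take b xs) @ rev (drop b xs)"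

lemma length_flip_ends [simp]:
  "\<lbrakk>a \<le> b; b \<le> length xs\<rbrakk> \<Longrightarrow> length (flip_ends a b xs) = length xs"
  by (simp add: flip_ends_def)

lemma take_flip_ends:
  "\<lbrakk>i \<le> a; a \<le> b; b \<le> length xs\<rbrakk> \<Longrightarrow> take i (flip_ends a b xs) = take i (rev (take a xs))"
  by (simp add: flip_ends_def)

lemma take_append_drop_take:
  assumes "a \<le> b"
  shows "take a xs @ drop a (take b xs) = take b xs"
  using append_take_drop_id[of a "take b xs"] assms by (simp add: min_absorb1)

lemma take_append_drop_take_append_drop:
  assumes "a \<le> b"
  shows "take a xs @ drop a (take b xs) @ drop b xs = xs"
  using take_append_drop_take[OF assms, of xs] by (metis append.assoc append_take_drop_id)

lemma flip_ends_flip_ends: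
  "\<lbrakk>a \<le> b; b \<le> length xs\<rbrakk> \<Longrightarrow> flip_ends a b (flip_ends a b xs) = xs"
  using take_append_drop_take_append_drop[of a b xs] by (simp add: flip_ends_def)

lemma set_take_flip_ends:
  assumes "a \<le> i" "i \<le> b" "b \<le> length xs"
  shows "set (take i (flip_ends a b xs)) = set (take i xs)"
proof -
  have "take i (flip_ends a b xs) = rev (take a xs) @ drop a (take i xs)"
    using assms by (simp add: flip_ends_def take_drop min_absorb1)
  then show ?thesis
    using take_append_drop_take[OF assms(1), of xs] by (metis set_append set_rev)
qed

lemma set_take_flip_ends_above:
  assumes "a \<le> b" "b \<le> i" "b \<le> length xs"
  shows "set (take i (flip_ends a b xs)) = set (take b xs) \<union> set (take (i - b) (rev (drop b xs)))"
proof -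
  have "take i (flip_ends a b xs)
      = rev (take a xs) @ drop a (take b xs) @ take (i - b) (rev (drop b xs))"
    using assms by (simp add: flip_ends_def)
  then show ?thesis
    using take_append_drop_take[OF assms(1), of xs] by (metis Un_assoc set_append set_rev)
qed

lemma mset_flip_ends:
  "a \<le> b \<Longrightarrow> mset (flip_ends a b xs) = mset xs"
  unfolding flip_ends_def by (metis take_append_drop_take_append_drop mset_append mset_rev)

lemma flip_ends_in_permutations_of_set:
  assumes "xs \<in> permutations_of_set V" "a \<le> b"
  shows "flip_ends a b xs \<in> permutations_of_set V"
  using permutations_of_setD[OF assms(1)] mset_flip_ends[OF assms(2), of xs]
  by (intro permutations_of_setI) (auto dest: mset_eq_setD mset_eq_imp_distinct_iff)

lemma set_take_not_subset_set_take_rev: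
  assumes "distinct xs" "0 < i" "j < length xs"
  shows "\<not> set (take i xs) \<subseteq> set (take j (rev xs))"
proof (cases xs)
  case (Cons x ys)
  then have "x \<in> set (take i xs)" "x \<notin> set (take j (rev xs))"
    using assms by (auto simp: take_Cons' dest: in_set_takeD)
  then show ?thesis by blast
qed (use assms in simp)

lemma set_take_rev_not_subset_set_take:
  assumes "distinct xs" "0 < j" "i < length xs"
  shows "\<not> set (take j (rev xs)) \<subseteq> set (take i xs)"
  using set_take_not_subset_set_take_rev[of "rev xs" j i] assms by simp

section \<open>Full chains and the members they meet\<close>

text \<open>A list enumerating the ground set without repetition encodes the full chain of its prefixes;
  a hit is the size of a prefix lying in the family.\<close>

definition hits :: "'a set set \<Rightarrow> 'a list \<Rightarrow> nat set" where
  "hits \<F> xs = {i. i \<le> length xs \<and> set (take i xs) \<in> \<F>}"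

lemma finite_hits [simp]: "finite (hits \<F> xs)"
  by (rule finite_subset[of _ "{..length xs}"]) (auto simp: hits_def)

lemma card_set_take_distinct:
  "\<lbrakk>distinct xs; i \<le> length xs\<rbrakk> \<Longrightarrow> card (set (take i xs)) = i"
  by (simp add: distinct_card)

lemma chain_prefix_sets:
  "Complete_Partial_Order.chain (\<subseteq>) ((\<lambda>i. set (take i xs)) ` T)"
  by (rule chain_imageI[of "(\<le>)"])
    (auto simp: chain_def intro: subsetD[OF set_take_subset_set_take])

lemma prefix_sets_of_hits:
  assumes "distinct xs" "T \<subseteq> hits \<F> xs"
  shows "finite ((\<lambda>i. set (take i xs)) ` T)"
    and "(\<lambda>i. set (take i xs)) ` T \<subseteq> \<F>"
    and "card ((\<lambda>i. set (take i xs)) ` T) = card T"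
proof -
  show "finite ((\<lambda>i. set (take i xs)) ` T)"
    using assms(2) by (intro finite_imageI finite_subset[OF _ finite_hits])
  show "(\<lambda>i. set (take i xs)) ` T \<subseteq> \<F>"
    using assms(2) by (auto simp: hits_def)
  show "card ((\<lambda>i. set (take i xs)) ` T) = card T"
    using assms
    by (intro card_image inj_on_inverseI[where g = card])
      (auto simp: hits_def card_set_take_distinct)
qed

lemma card_hits:
  assumes xs: "xs \<in> permutations_of_set V" and "\<F> \<subseteq> Pow V"
  shows "card (hits \<F> xs) = card {F \<in> \<F>. set (take (card F) xs) = F}"
proof -
  have "distinct xs" "set xs = V" using xs by (auto dest: permutations_of_setD)
  moreover from this have "card F \<le> length xs" if "F \<in> \<F>" for F
    using that assms(2) by (metis PowD card_mono distinct_card finite_set subsetD)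
  ultimately have "bij_betw (\<lambda>i. set (take i xs)) (hits \<F> xs) {F \<in> \<F>. set (take (card F) xs) = F}"
    by (intro bij_betw_byWitness[where f' = card]) (auto simp: hits_def card_set_take_distinct)
  then show ?thesis by (rule bij_betw_same_card)
qed

lemma card_permutations_with_prefix_set:
  assumes "finite V" "F \<subseteq> V"
  shows "card {xs \<in> permutations_of_set V. set (take (card F) xs) = F}
     = fact (card F) * fact (card V - card F)"
proof -
  have "finite F" using assms finite_subset by auto
  have "{xs \<in> permutations_of_set V. set (take (card F) xs) = F}
      = (\<lambda>(us, vs). us @ vs) ` (permutations_of_set F \<times> permutations_of_set (V - F))"
    (is "?S = _ ` ?P")
  proof (intro equalityI subsetI)
    fix xs assume xs: "xs \<in> ?S"
    define us vs where "us = take (card F) xs" and "vs = drop (card F) xs"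
    have "xs = us @ vs" by (simp add: us_def vs_def)
    moreover have "set us = F" "distinct (us @ vs)" "set (us @ vs) = V"
      using xs by (simp_all add: us_def vs_def permutations_of_set_def)
    then have "us \<in> permutations_of_set F" "vs \<in> permutations_of_set (V - F)"
      by (auto simp: permutations_of_set_def)
    ultimately show "xs \<in> (\<lambda>(us, vs). us @ vs) ` ?P" by auto
  qed (use assms in \<open>auto simp: permutations_of_set_def simp flip: distinct_card\<close>)
  moreover have "inj_on (\<lambda>(us, vs). us @ vs) ?P"
    by (auto simp: inj_on_def length_finite_permutations_of_set)
  ultimately have "card ?S = card ?P" by (simp add: card_image)
  then show ?thesis
    using \<open>finite F\<close> assms by (simp add: card_Diff_subset)
qed

lemma sum_inverse_binomial_eq_average_hits:
  assumes "finite V" "\<F> \<subseteq> Pow V"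
  shows "(\<Sum>F\<in>\<F>. 1 / real (card V choose card F))
     = real (\<Sum>xs\<in>permutations_of_set V. card (hits \<F> xs)) / fact (card V)"
proof -
  let ?n = "card V"
  have "(\<Sum>xs\<in>permutations_of_set V. card (hits \<F> xs))
      = (\<Sum>xs\<in>permutations_of_set V. card {F \<in> \<F>. set (take (card F) xs) = F})"
    using card_hits[OF _ assms(2)] by simp
  also have "\<dots> = (\<Sum>F\<in>\<F>. fact (card F) * fact (?n - card F))"
    using assms card_permutations_with_prefix_set[OF assms(1)]
    by (intro sum_multicount_gen) (auto dest: finite_subset)
  finally have "real (\<Sum>xs\<in>permutations_of_set V. card (hits \<F> xs)) / fact ?n
      = (\<Sum>F\<in>\<F>. fact (card F) * fact (?n - card F) / fact ?n)"
    by (simp add: sum_divide_distrib)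
  also have "\<dots> = (\<Sum>F\<in>\<F>. 1 / real (?n choose card F))"
    using assms by (intro sum.cong) (auto simp: binomial_fact card_mono)
  finally show ?thesis by simp
qed

section \<open>Families free of \<open>Y\<^sub>k\<close> and its dual\<close>

locale Y_free_family =
  fixes V :: "'a set" and \<F> :: "'a set set" and k :: nat
  assumes finite_ground: "finite V"
    and subset_Pow: "\<F> \<subseteq> Pow V"
    and k_ge_2: "k \<ge> 2"
    and Y_free: "\<not> contains_Y k \<F>"
    and Y_dual_free: "\<not> contains_Y_dual k \<F>"
    and empty_notin: "{} \<notin> \<F>"
    and ground_notin: "V \<notin> \<F>"
begin

lemma hits_strictly_between:
  assumes "xs \<in> permutations_of_set V" "i \<in> hits \<F> xs"
  shows "0 < i" "i < length xs"
proof -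
  have "i \<noteq> 0"
    using assms(2) empty_notin by (intro notI) (simp add: hits_def)
  moreover have "i \<noteq> length xs"
    using assms ground_notin by (auto simp: hits_def permutations_of_set_def)
  ultimately show "0 < i" "i < length xs"
    using assms(2) by (auto simp: hits_def)
qed

lemma comparable_below_hits:
  assumes "distinct xs" "T \<subseteq> hits \<F> xs" "card T = k"
    and "A \<in> \<F>" "B \<in> \<F>" "\<And>t. t \<in> T \<Longrightarrow> A \<union> B \<subseteq> set (take t xs)"
  shows "A \<subseteq> B \<or> B \<subseteq> A"
proof (rule ccontr)
  assume "\<not> (A \<subseteq> B \<or> B \<subseteq> A)"
  then have "\<not> A \<subseteq> B" "\<not> B \<subseteq> A" by simp_all
  then have "contains_Y_dual k \<F>"
    using prefix_sets_of_hits[OF assms(1,2)] assms(3-6)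
    by (intro contains_Y_dualI[OF _ chain_prefix_sets]) auto
  then show False using Y_dual_free by simp
qed

lemma comparable_above_hits:
  assumes "distinct xs" "T \<subseteq> hits \<F> xs" "card T = k"
    and "A \<in> \<F>" "B \<in> \<F>" "\<And>t. t \<in> T \<Longrightarrow> set (take t xs) \<subseteq> A \<inter> B"
  shows "A \<subseteq> B \<or> B \<subseteq> A"
proof (rule ccontr)
  assume "\<not> (A \<subseteq> B \<or> B \<subseteq> A)"
  then have "\<not> A \<subseteq> B" "\<not> B \<subseteq> A" by simp_all
  then have "contains_Y k \<F>"
    using prefix_sets_of_hits[OF assms(1,2)] assms(3-6)
    by (intro contains_YI[OF _ chain_prefix_sets]) auto
  then show False using Y_free by simp
qed

lemma reversed_prefix_notin:
  assumes xs: "xs \<in> permutations_of_set V"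
    and k_hits: "T \<subseteq> hits \<F> xs" "card T = k" "T \<subseteq> {a..}"
    and l: "l \<in> hits \<F> xs" "l < a" and "a \<le> length xs" "i < a"
  shows "set (take i (rev (take a xs))) \<notin> \<F>"
proof
  let ?S = "set (take i (rev (take a xs)))" and ?L = "set (take l (take a xs))"
  assume member: "?S \<in> \<F>"
  have "distinct xs" using xs by (rule permutations_of_setD)
  have "?S \<union> ?L \<subseteq> set (take a xs)"
    using set_take_subset[of i "rev (take a xs)"] set_take_subset[of l "take a xs"] by simp
  then have "?S \<union> ?L \<subseteq> set (take t xs)" if "t \<in> T" for t
    using k_hits(3) that set_take_subset_set_take[of a t xs] by auto
  moreover have "?L \<in> \<F>"
    using l by (simp add: hits_def min_def)
  ultimately have "?S \<subseteq> ?L \<or> ?L \<subseteq> ?S"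
    using \<open>distinct xs\<close> k_hits(1,2) member by (intro comparable_below_hits)
  moreover have "0 < i"
    using member empty_notin by (cases i) auto
  moreover have "0 < l"
    using xs l(1) by (rule hits_strictly_between)
  ultimately show False
    using set_take_not_subset_set_take_rev[of "take a xs" l i]
      set_take_rev_not_subset_set_take[of "take a xs" i l] \<open>distinct xs\<close> assms by auto
qed

lemma reversed_suffix_notin:
  assumes xs: "xs \<in> permutations_of_set V"
    and k_hits: "T \<subseteq> hits \<F> xs" "card T = k" "T \<subseteq> {..b}"
    and h: "h \<in> hits \<F> xs" "b < h" and "0 < i" "b + i \<le> length xs"
  shows "set (take b xs) \<union> set (take i (rev (drop b xs))) \<notin> \<F>"
proof
  let ?D = "set (take b xs)" and ?R = "set (take i (rev (drop b xs)))"
    and ?U = "set (take (h - b) (drop b xs))"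
  assume member: "?D \<union> ?R \<in> \<F>"
  have enum_xs: "distinct xs" "set xs = V" using xs by (auto dest: permutations_of_setD)
  have "take h xs = take b xs @ take (h - b) (drop b xs)"
    using h(2) by (simp flip: take_add)
  then have "?D \<union> ?U \<in> \<F>"
    using h(1) by (simp add: hits_def)
  moreover have "set (take t xs) \<subseteq> ?D" if "t \<in> T" for t
    using k_hits(3) that by (intro set_take_subset_set_take) auto
  ultimately have "?D \<union> ?R \<subseteq> ?D \<union> ?U \<or> ?D \<union> ?U \<subseteq> ?D \<union> ?R"
    using enum_xs k_hits(1,2) member by (intro comparable_above_hits) auto
  moreover have "?D \<inter> set (drop b xs) = {}" "?R \<union> ?U \<subseteq> set (drop b xs)"
    using enum_xs by (auto simp: set_take_disj_set_drop_if_distinct dest: in_set_takeD)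
  ultimately have "?R \<subseteq> ?U \<or> ?U \<subseteq> ?R"
    by blast
  moreover have "b + i \<noteq> length xs"
  proof
    assume "b + i = length xs"
    then have "?D \<union> ?R = set (take b xs @ drop b xs)"
      by (subst set_append) simp
    then show False using member ground_notin enum_xs by simp
  qed
  moreover have "h < length xs"
    using xs h(1) by (rule hits_strictly_between)
  ultimately show False
    using set_take_not_subset_set_take_rev[of "drop b xs" "h - b" i]
      set_take_rev_not_subset_set_take[of "drop b xs" i "h - b"] enum_xs assms by auto
qed

lemma hits_flip_ends:
  assumes xs: "xs \<in> permutations_of_set V" and win: "(a, b) \<in> windows (k - 1) (hits \<F> xs)"
  shows "hits \<F> (flip_ends a b xs) = hits \<F> xs \<inter> {a..b}"
proof -
  let ?W = "hits \<F> xs \<inter> {a..b}"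
  obtain l h where "a \<le> b" and ab: "a \<in> hits \<F> xs" "b \<in> hits \<F> xs" and card_W: "card ?W = k - 1"
    and l: "l \<in> hits \<F> xs" "l < a" and h: "h \<in> hits \<F> xs" "b < h"
    using win by (auto simp: windows_def)
  have "b \<le> length xs" using ab by (simp add: hits_def)
  have card_insert: "card (insert l ?W) = k" "card (insert h ?W) = k"
    using card_W l h k_ge_2 by simp_all
  have insert_subset: "insert l ?W \<subseteq> hits \<F> xs" "insert l ?W \<subseteq> {..b}"
    "insert h ?W \<subseteq> hits \<F> xs" "insert h ?W \<subseteq> {a..}"
    using l h \<open>a \<le> b\<close> by auto
  show ?thesis
  proof (rule set_eqI)
    fix i
    consider "i < a" | "a \<le> i" "i \<le> b" | "b < i" "i \<le> length xs" | "length xs < i" by linarith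
    then show "i \<in> hits \<F> (flip_ends a b xs) \<longleftrightarrow> i \<in> ?W"
    proof cases
      case 1
      then have "set (take i (flip_ends a b xs)) \<notin> \<F>"
        using reversed_prefix_notin[OF xs insert_subset(3) card_insert(2) insert_subset(4) l]
          \<open>a \<le> b\<close> \<open>b \<le> length xs\<close> by (simp add: take_flip_ends)
      then show ?thesis using 1 by (simp add: hits_def)
    next
      case 2
      then show ?thesis
        using \<open>b \<le> length xs\<close> by (simp add: hits_def set_take_flip_ends)
    next
      case 3
      then have "set (take i (flip_ends a b xs)) \<notin> \<F>"
        using reversed_suffix_notin
            [OF xs insert_subset(1) card_insert(1) insert_subset(2) h, of "i - b"]
          \<open>a \<le> b\<close> \<open>b \<le> length xs\<close> by (simp add: set_take_flip_ends_above)
      then show ?thesis using 3 by (simp add: hits_def)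
    next
      case 4
      then show ?thesis
        using \<open>a \<le> b\<close> \<open>b \<le> length xs\<close> by (simp add: hits_def)
    qed
  qed
qed

lemma flip_ends_window:
  assumes xs: "xs \<in> permutations_of_set V" and win: "(a, b) \<in> windows (k - 1) (hits \<F> xs)"
  shows "flip_ends a b xs \<in> permutations_of_set V"
    and "flip_ends a b (flip_ends a b xs) = xs"
    and "card (hits \<F> (flip_ends a b xs)) = k - 1"
    and "Min (hits \<F> (flip_ends a b xs)) = a"
    and "Max (hits \<F> (flip_ends a b xs)) = b"
proof -
  have ab: "a \<le> b" "b \<le> length xs" "a \<in> hits \<F> xs" "b \<in> hits \<F> xs"
    "card (hits \<F> xs \<inter> {a..b}) = k - 1"
    using win by (auto simp: windows_def hits_def)
  then show "flip_ends a b xs \<in> permutations_of_set V"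
    "flip_ends a b (flip_ends a b xs) = xs" "card (hits \<F> (flip_ends a b xs)) = k - 1"
    using xs by (simp_all add: flip_ends_in_permutations_of_set flip_ends_flip_ends
        hits_flip_ends[OF assms])
  show "Min (hits \<F> (flip_ends a b xs)) = a" "Max (hits \<F> (flip_ends a b xs)) = b"
    using ab by (auto simp: hits_flip_ends[OF assms] intro!: Min_eqI Max_eqI)
qed

lemma sum_card_windows_le:
  "(\<Sum>xs\<in>permutations_of_set V. card (windows (k - 1) (hits \<F> xs)))
     \<le> card {xs \<in> permutations_of_set V. card (hits \<F> xs) = k - 1}"
proof -
  let ?W = "SIGMA xs:permutations_of_set V. windows (k - 1) (hits \<F> xs)"
  have "inj_on (\<lambda>(xs, a, b). flip_ends a b xs) ?W"
  proof (rule inj_onI, clarify)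
    fix xs a b ys c d
    assume xs: "xs \<in> permutations_of_set V" "(a, b) \<in> windows (k - 1) (hits \<F> xs)"
      and ys: "ys \<in> permutations_of_set V" "(c, d) \<in> windows (k - 1) (hits \<F> ys)"
      and eq: "flip_ends a b xs = flip_ends c d ys"
    have "a = c" "b = d"
      using flip_ends_window(4,5)[OF xs] flip_ends_window(4,5)[OF ys] by (simp_all add: eq)
    then show "xs = ys \<and> (a, b) = (c, d)"
      using flip_ends_window(2)[OF xs] flip_ends_window(2)[OF ys] eq by metis
  qed
  moreover have "(\<lambda>(xs, a, b). flip_ends a b xs) ` ?W
      \<subseteq> {xs \<in> permutations_of_set V. card (hits \<F> xs) = k - 1}"
    using flip_ends_window(1,3) by auto
  ultimately have "card ?W \<le> card {xs \<in> permutations_of_set V. card (hits \<F> xs) = k - 1}"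
    by (intro card_inj_on_le) auto
  then show ?thesis by simp
qed

lemma sum_card_hits_le:
  "(\<Sum>xs\<in>permutations_of_set V. card (hits \<F> xs)) \<le> k * fact (card V)"
proof -
  let ?P = "permutations_of_set V" and ?m = "k - 1"
  let ?w = "\<lambda>xs. card (windows ?m (hits \<F> xs))"
  have "card (hits \<F> xs) + (if card (hits \<F> xs) = ?m then 1 else 0) \<le> k + ?w xs" for xs
    using card_le_card_windows[of "hits \<F> xs" ?m] k_ge_2 by auto
  then have "(\<Sum>xs\<in>?P. card (hits \<F> xs) + (if card (hits \<F> xs) = ?m then 1 else 0))
      \<le> (\<Sum>xs\<in>?P. k + ?w xs)"
    by (intro sum_mono)
  then have "(\<Sum>xs\<in>?P. card (hits \<F> xs)) + card {xs \<in> ?P. card (hits \<F> xs) = ?m}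
      \<le> k * fact (card V) + (\<Sum>xs\<in>?P. ?w xs)"
    using finite_ground by (simp add: sum.distrib sum.If_cases Int_def mult.commute)
  then show ?thesis using sum_card_windows_le by simp
qed

lemma sum_inverse_binomial_le: "(\<Sum>F\<in>\<F>. 1 / real (card V choose card F)) \<le> real k"
proof -
  have "real (\<Sum>xs\<in>permutations_of_set V. card (hits \<F> xs)) \<le> real (k * fact (card V))"
    using sum_card_hits_le by (rule of_nat_mono)
  then show ?thesis
    unfolding sum_inverse_binomial_eq_average_hits[OF finite_ground subset_Pow]
    by (simp add: divide_le_eq)
qed

end

section \<open>From the weight bound to the cardinality bound\<close>

text \<open>For a threshold \<open>t\<close> between the values of \<open>c\<close> outside and inside \<open>A\<close>,
  \<open>\<Sum>i\<in>I. x i * c i = (\<Sum>i\<in>I. x i * (c i - t)) + t * sum x I \<le> (\<Sum>i\<in>A. c i - t) + t * card A\<close>.\<close>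

lemma weighted_sum_le_sum_dominating:
  fixes x c :: "'i \<Rightarrow> 'a::linordered_idom"
  assumes "finite I" "A \<subseteq> I"
    and x: "\<And>i. i \<in> I \<Longrightarrow> 0 \<le> x i" "\<And>i. i \<in> I \<Longrightarrow> x i \<le> 1"
    and sum: "sum x I \<le> of_nat (card A)"
    and c: "\<And>i. i \<in> I \<Longrightarrow> 0 \<le> c i" "\<And>i j. \<lbrakk>i \<in> A; j \<in> I - A\<rbrakk> \<Longrightarrow> c j \<le> c i"
  shows "(\<Sum>i\<in>I. x i * c i) \<le> sum c A"
proof -
  define t where "t = Max (insert 0 (c ` (I - A)))"
  have "0 \<le> t" using \<open>finite I\<close> by (simp add: t_def)
  have inside: "t \<le> c i" if "i \<in> A" for i
    unfolding t_def using that assms by (subst Max_le_iff) auto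
  have outside: "c i \<le> t" if "i \<in> I - A" for i
    unfolding t_def using that \<open>finite I\<close> by (intro Max_ge) auto
  have "(\<Sum>i\<in>I. x i * (c i - t)) = (\<Sum>i\<in>I - A. x i * (c i - t)) + (\<Sum>i\<in>A. x i * (c i - t))"
    using assms(2,1) by (rule sum.subset_diff)
  also have "\<dots> \<le> (\<Sum>i\<in>I - A. 0) + (\<Sum>i\<in>A. c i - t)"
    using x inside outside \<open>A \<subseteq> I\<close>
    by (intro add_mono sum_mono) (auto intro!: mult_left_le_one_le mult_nonneg_nonpos)
  finally have "(\<Sum>i\<in>I. x i * (c i - t)) \<le> sum c A - of_nat (card A) * t"
    by (simp add: sum_subtractf)
  moreover have "sum x I * t \<le> of_nat (card A) * t"
    using sum \<open>0 \<le> t\<close> by (rule mult_right_mono)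
  ultimately show ?thesis
    by (simp add: right_diff_distrib sum_subtractf sum_distrib_right)
qed

lemma sum_list_take_rev_sort_map:
  fixes f :: "'a \<Rightarrow> 'b::{linorder, comm_monoid_add}"
  assumes "distinct xs" "k \<le> length xs"
  obtains A where "A \<subseteq> set xs" "card A = k" "sum_list (take k (rev (sort (map f xs)))) = sum f A"
    "\<And>a b. \<lbrakk>a \<in> A; b \<in> set xs - A\<rbrakk> \<Longrightarrow> f b \<le> f a"
proof -
  define ys where "ys = rev (sort_key f xs)"
  have ys: "distinct ys" "set ys = set xs" "length ys = length xs"
    using assms(1) by (simp_all add: ys_def)
  have split: "set (take k ys) \<union> set (drop k ys) = set xs"
    using ys(2) by (metis append_take_drop_id set_append)
  have "sort (map f xs) = map f (sort_key f xs)"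
    by (rule properties_for_sort) simp_all
  then have map_ys: "rev (sort (map f xs)) = map f ys"
    by (simp add: ys_def rev_map)
  have "sorted_wrt (\<ge>) (map f ys)"
    by (simp add: sorted_wrt_rev flip: map_ys)
  then have "sorted_wrt (\<ge>) (map f (take k ys) @ map f (drop k ys))"
    by (simp flip: map_append)
  then have "f b \<le> f a" if "a \<in> set (take k ys)" "b \<in> set (drop k ys)" for a b
    using that unfolding map_append sorted_wrt_append by simp
  moreover have "sum_list (take k (rev (sort (map f xs)))) = sum f (set (take k ys))"
    using ys(1) by (simp add: map_ys take_map sum_list_distinct_conv_sum_set)
  moreover have "card (set (take k ys)) = k"
    using ys assms(2) by (simp add: card_set_take_distinct)
  ultimately show ?thesis
    using split by (intro that[of "set (take k ys)"]) auto
qed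

lemma sum_by_card:
  fixes f :: "nat \<Rightarrow> 'b::semiring_1"
  assumes "finite V" "\<F> \<subseteq> Pow V"
  shows "(\<Sum>F\<in>\<F>. f (card F)) = (\<Sum>i\<le>card V. of_nat (card {F \<in> \<F>. card F = i}) * f i)"
proof -
  have "finite \<F>" "card ` \<F> \<subseteq> {..card V}"
    using assms by (auto simp: card_mono dest: finite_subset)
  then have "(\<Sum>F\<in>\<F>. f (card F)) = (\<Sum>i\<le>card V. \<Sum>F\<in>{F \<in> \<F>. card F = i}. f (card F))"
    by (intro sum.group[symmetric]) auto
  then show ?thesis by simp
qed

lemma card_level_le_binomial:
  assumes "finite V" "\<F> \<subseteq> Pow V"
  shows "card {F \<in> \<F>. card F = i} \<le> card V choose i"
proof -
  have "card {F \<in> \<F>. card F = i} \<le> card {F. F \<subseteq> V \<and> card F = i}"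
    using assms by (intro card_mono) auto
  then show ?thesis using assms by (simp add: n_subsets)
qed

lemma largest_binomials_sum_eq_sum:
  assumes "k \<le> n + 1"
  obtains A where "A \<subseteq> {..n}" "card A = k" "largest_binomials_sum n k = (\<Sum>i\<in>A. n choose i)"
    "\<And>i j. \<lbrakk>i \<in> A; j \<in> {..n} - A\<rbrakk> \<Longrightarrow> n choose j \<le> n choose i"
proof -
  have "distinct [0..<Suc n]" "k \<le> length [0..<Suc n]" "set [0..<Suc n] = {..n}"
    using assms by auto
  then show ?thesis
    using sum_list_take_rev_sort_map[of "[0..<Suc n]" k "(choose) n"] that
    unfolding largest_binomials_sum_def by metis
qed

lemma card_le_largest_binomials_sum:
  assumes V: "finite V" "\<F> \<subseteq> Pow V" and "k \<le> card V + 1"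
    and LYM: "(\<Sum>F\<in>\<F>. 1 / real (card V choose card F)) \<le> real k"
  shows "card \<F> \<le> largest_binomials_sum (card V) k"
proof -
  let ?n = "card V"
  define x where "x i = real (card {F \<in> \<F>. card F = i}) / real (?n choose i)" for i
  obtain A where "A \<subseteq> {..?n}" "card A = k"
    and sum_A: "largest_binomials_sum ?n k = (\<Sum>i\<in>A. ?n choose i)"
    and dominating: "\<And>i j. \<lbrakk>i \<in> A; j \<in> {..?n} - A\<rbrakk> \<Longrightarrow> ?n choose j \<le> ?n choose i"
    using largest_binomials_sum_eq_sum[OF \<open>k \<le> ?n + 1\<close>] by blast
  have "real (card \<F>) = (\<Sum>i\<le>?n. x i * real (?n choose i))"
    using sum_by_card[OF V, of "\<lambda>_. 1 :: real"] by (simp add: x_def)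
  also have "\<dots> \<le> (\<Sum>i\<in>A. real (?n choose i))"
  proof (rule weighted_sum_le_sum_dominating)
    show "sum x {..?n} \<le> real (card A)"
      using LYM sum_by_card[OF V, of "\<lambda>i. 1 / real (?n choose i)"] \<open>card A = k\<close> by (simp add: x_def)
    show "x i \<le> 1" if "i \<in> {..?n}" for i
      using card_level_le_binomial[OF V, of i] that by (simp add: x_def)
  qed (use \<open>A \<subseteq> {..?n}\<close> dominating in \<open>auto simp: x_def\<close>)
  also have "\<dots> = real (largest_binomials_sum ?n k)"
    by (simp add: sum_A)
  finally show ?thesis by simp
qed

theorem theorem1p3:
  fixes k n :: nat and \<F> :: "nat set set"
  assumes "k \<ge> 2" and "n \<ge> k + 1"
    and "\<F> \<subseteq> Pow {1..n}"
    and "\<not> contains_Y k \<F>" and "\<not> contains_Y_dual k \<F>"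
    and "{} \<notin> \<F>" and "{1..n} \<notin> \<F>"
  shows "(\<Sum>F\<in>\<F>. 1 / real (n choose card F)) \<le> real k \<and>
         card \<F> \<le> largest_binomials_sum n k"
proof -
  interpret Y_free_family "{1..n}" \<F> k
    using assms by unfold_locales auto
  have "card \<F> \<le> largest_binomials_sum (card {1..n}) k"
    using assms by (intro card_le_largest_binomials_sum sum_inverse_binomial_le) auto
  then show ?thesis
    using sum_inverse_binomial_le by simp
qed

end
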